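(* Suppose that $X$ is a connected CW complex and let $\mu, \widetilde{\mu} \in C(X)[\lambda]$ be multiplicity-free monic polynomials that split over $C(X)$ and have the same degree $n$. Then the number of unitary equivalence classes of normal matrices in $\mathrm{M}(n,C(X))$ with characteristic polynomial $\mu$ is equal to the number of unitary equivalence classes of normal matrices in $\mathrm{M}(n,C(X))$ with characteristic polynomial $\widetilde{\mu}$.
   Context: $C(X)$ is the algebra of continuous complex-valued functions on $X$, and $\mathrm{M}(n,C(X))$ is the ring of $n\times n$ matrices over $C(X)$; $A^*$ denotes the pointwise conjugate transpose, and $A$ is normal if $AA^*=A^*A$. Characteristic polynomials are taken to be monic. A monic polynomial $\mu\in C(X)[\lambda]$ of degree $n$ splits over $C(X)$ if $\mu(\lambda)=\prod_{i=1}^n(\lambda-\lambda_i)$ for some $\lambda_1,\dots,\lambda_n\in C(X)$; it is multiplicity-free if for each $x\in X$ the polynomial over $\mathbb{C}$ obtained by evaluating the coefficients at $x$ has $n$ distinct roots. Matrices $A,B\in\mathrm{M}(n,C(X))$ are unitarily equivalent if $B=U^*AU$ for some $U\in\mathrm{M}(n,C(X))$ with $U^*U=UU^*=I$. "Number" means cardinality (possibly infinite). *)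

theory Defs
  imports
    "HOL-Analysis.Abstract_Euclidean_Space"
    "HOL-Analysis.T1_Spaces"
    "HOL-Library.Equipollence"
    "Jordan_Normal_Form.Char_Poly"
begin

section \<open>CW complexes\<close>

text \<open>The open unit ball, the unit sphere and the closed unit disc of \<open>n\<close>-dimensional space, in the
  library's model of it: sequences that vanish from index \<open>n\<close> on. For \<open>n = 0\<close> the ball and the disc
  are a point and the sphere is empty.\<close>

definition unit_ball :: "nat \<Rightarrow> (nat \<Rightarrow> real) set" where
  "unit_ball n = {x \<in> topspace (Euclidean_space n). (\<Sum>i<n. (x i)\<^sup>2) < 1}"

definition unit_sphere :: "nat \<Rightarrow> (nat \<Rightarrow> real) set" where
  "unit_sphere n = {x \<in> topspace (Euclidean_space n). (\<Sum>i<n. (x i)\<^sup>2) = 1}"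

definition unit_disc :: "nat \<Rightarrow> (nat \<Rightarrow> real) set" where
  "unit_disc n = {x \<in> topspace (Euclidean_space n). (\<Sum>i<n. (x i)\<^sup>2) \<le> 1}"

definition characteristic_map :: "'a topology \<Rightarrow> nat \<Rightarrow> 'a set \<Rightarrow> ((nat \<Rightarrow> real) \<Rightarrow> 'a) \<Rightarrow> bool" where
  "characteristic_map X n e \<Phi> \<longleftrightarrow>
     continuous_map (subtopology (Euclidean_space n) (unit_disc n)) X \<Phi> \<and>
     homeomorphic_map (subtopology (Euclidean_space n) (unit_ball n)) (subtopology X e) \<Phi>"

text \<open>\<open>E n\<close> is the set of open \<open>n\<close>-cells. The fourth conjunct is closure-finiteness together with
  the requirement that boundaries lie in cells of lower dimension; the last one says that \<open>X\<close> has the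
  weak topology.\<close>

definition cw_structure :: "'a topology \<Rightarrow> (nat \<Rightarrow> 'a set set) \<Rightarrow> bool" where
  "cw_structure X E \<longleftrightarrow>
     Hausdorff_space X \<and>
     (\<Union>n. \<Union>(E n)) = topspace X \<and>
     (\<forall>m n. \<forall>d\<in>E m. \<forall>e\<in>E n. (m, d) \<noteq> (n, e) \<longrightarrow> disjnt d e) \<and>
     (\<forall>n. \<forall>e\<in>E n. \<exists>\<Phi> F. characteristic_map X n e \<Phi> \<and>
        finite F \<and> F \<subseteq> (\<Union>m<n. E m) \<and> \<Phi> ` unit_sphere n \<subseteq> \<Union>F) \<and>
     (\<forall>C \<subseteq> topspace X.
        (\<forall>n. \<forall>e\<in>E n. closedin X (C \<inter> X closure_of e)) \<longrightarrow> closedin X C)"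

definition CW_complex :: "'a topology \<Rightarrow> bool" where
  "CW_complex X \<longleftrightarrow> (\<exists>E. cw_structure X E)"


section \<open>The algebra of continuous complex-valued functions\<close>

typedef (overloaded) ('a :: topological_space) cfun =
  "{f :: 'a \<Rightarrow> complex. continuous_on UNIV f}"
  morphisms cfun_apply Cfun
  by (rule exI[of _ "\<lambda>_. 0"]) simp

setup_lifting type_definition_cfun

instantiation cfun :: (topological_space) comm_ring_1
begin

lift_definition zero_cfun :: "'a cfun" is "\<lambda>_. 0" by simp
lift_definition one_cfun :: "'a cfun" is "\<lambda>_. 1" by simp
lift_definition plus_cfun :: "'a cfun \<Rightarrow> 'a cfun \<Rightarrow> 'a cfun" is "\<lambda>f g x. f x + g x"
  by (intro continuous_intros)
lift_definition minus_cfun :: "'a cfun \<Rightarrow> 'a cfun \<Rightarrow> 'a cfun" is "\<lambda>f g x. f x - g x"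
  by (intro continuous_intros)
lift_definition uminus_cfun :: "'a cfun \<Rightarrow> 'a cfun" is "\<lambda>f x. - f x"
  by (intro continuous_intros)
lift_definition times_cfun :: "'a cfun \<Rightarrow> 'a cfun \<Rightarrow> 'a cfun" is "\<lambda>f g x. f x * g x"
  by (intro continuous_intros)

instance
  by standard (transfer; simp add: algebra_simps fun_eq_iff)+

end

lift_definition cfun_cnj :: "'a :: topological_space cfun \<Rightarrow> 'a cfun" is "\<lambda>f x. cnj (f x)"
  by (intro continuous_intros)


section \<open>Polynomials and matrices over this algebra\<close>

definition eval_poly_at :: "'a :: topological_space \<Rightarrow> 'a cfun poly \<Rightarrow> complex poly" where
  "eval_poly_at x p = map_poly (\<lambda>f. cfun_apply f x) p"

definition splits :: "'a :: topological_space cfun poly \<Rightarrow> bool" where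
  "splits p \<longleftrightarrow> (\<exists>l :: nat \<Rightarrow> 'a cfun. p = (\<Prod>i<degree p. [:- l i, 1:]))"

definition multiplicity_free :: "'a :: topological_space cfun poly \<Rightarrow> bool" where
  "multiplicity_free p \<longleftrightarrow> (\<forall>x. card {z. poly (eval_poly_at x p) z = 0} = degree p)"

definition cfun_adjoint :: "'a :: topological_space cfun mat \<Rightarrow> 'a cfun mat" where
  "cfun_adjoint A = transpose_mat (map_mat cfun_cnj A)"

definition normal_mat :: "'a :: topological_space cfun mat \<Rightarrow> bool" where
  "normal_mat A \<longleftrightarrow> A * cfun_adjoint A = cfun_adjoint A * A"

definition unitary_equiv :: "nat \<Rightarrow> ('a :: topological_space cfun mat \<times> 'a cfun mat) set" where
  "unitary_equiv n = {(A, B). A \<in> carrier_mat n n \<and> B \<in> carrier_mat n n \<and>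
     (\<exists>U \<in> carrier_mat n n. cfun_adjoint U * U = 1\<^sub>m n \<and> U * cfun_adjoint U = 1\<^sub>m n \<and>
        B = cfun_adjoint U * A * U)}"

definition normal_mats_with_char_poly ::
    "nat \<Rightarrow> 'a :: topological_space cfun poly \<Rightarrow> 'a cfun mat set" where
  "normal_mats_with_char_poly n p = {A \<in> carrier_mat n n. normal_mat A \<and> char_poly A = p}"

end

theory Submission
  imports Defs
begin

text \<open>
  The eigenvalues of a normal matrix can be changed without touching its eigenspaces, and they can be
  changed by a polynomial with coefficients in \<open>C(X)\<close>. Write the two polynomials as
  \<open>\<mu> = (\<lambda> - l\<^sub>1) \<dots> (\<lambda> - l\<^sub>n)\<close> and \<open>\<mu>' = (\<lambda> - m\<^sub>1) \<dots> (\<lambda> - m\<^sub>n)\<close>. As \<open>\<mu>\<close> is multiplicity-free, a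
  difference \<open>l\<^sub>j - l\<^sub>i\<close> with \<open>i \<noteq> j\<close> vanishes nowhere and so is a unit of \<open>C(X)\<close>. That is
  all that interpolation needs: some \<open>q \<in> C(X)[\<lambda>]\<close> satisfies \<open>q(l\<^sub>i) = m\<^sub>i\<close> for all \<open>i\<close>, and in
  the same way some \<open>r\<close> satisfies \<open>r(m\<^sub>i) = l\<^sub>i\<close> (\<open>cfun_interpolation\<close>). The bijection of
  unitary equivalence classes is induced by \<open>A \<mapsto> q(A)\<close>, with inverse \<open>B \<mapsto> r(B)\<close>.

  Every algebraic property of these maps comes from one fact, \<open>mat_poly_intertwine\<close>: if \<open>A S = S B\<close>
  then \<open>p(A) S = S p(B)\<close>. With \<open>S\<close> unitary it shows that \<open>A \<mapsto> p(A)\<close> respects unitary equivalence;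
  with \<open>S\<close> the adjoint of \<open>A\<close> it shows that \<open>p(A)\<close> is again normal; with \<open>S\<close> a matrix of eigenvectors
  and \<open>B\<close> diagonal it computes \<open>p(A)\<close>.

  The characteristic polynomial of \<open>q(A)\<close> and the identity \<open>r(q(A)) = A\<close> can be checked at each point
  \<open>x\<close> separately. There \<open>A(x)\<close> has \<open>n\<close> distinct complex eigenvalues and hence a basis of eigenvectors
  (\<open>diagonalize_simple_spectrum\<close>). In that basis \<open>A\<close>, \<open>q(A)\<close> and \<open>r(q(A))\<close> are diagonal with
  entries \<open>l\<^sub>i(x)\<close>, \<open>m\<^sub>i(x)\<close> and \<open>l\<^sub>i(x)\<close>. These bases need not depend continuously on \<open>x\<close>; they
  only serve to verify identities between matrices that are already known to be continuous.
\<close>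

section \<open>Polynomials of matrices\<close>

text \<open>Horner's scheme. The size \<open>n\<close> is an argument because matrices of all sizes share one type, which
  therefore has no unit that could stand for the constant polynomial \<open>1\<close>.\<close>

definition mat_poly :: "nat \<Rightarrow> 'r :: comm_ring_1 poly \<Rightarrow> 'r mat \<Rightarrow> 'r mat" where
  "mat_poly n p A = fold_coeffs (\<lambda>c M. c \<cdot>\<^sub>m 1\<^sub>m n + A * M) p (0\<^sub>m n n)"

lemma mat_poly_0 [simp]: "mat_poly n 0 A = 0\<^sub>m n n"
  by (simp add: mat_poly_def)

text \<open>The Horner step also has to hold for \<open>c = 0\<close>, \<open>p = 0\<close>, where \<open>fold_coeffs\<close> sees no coefficient
  at all; there it relies on \<open>A\<close> being \<open>n \<times> n\<close>.\<close>

lemma mat_poly_pCons: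
  assumes "A \<in> carrier_mat n n"
  shows "mat_poly n (pCons c p) A = c \<cdot>\<^sub>m 1\<^sub>m n + A * mat_poly n p A"
proof (cases "c = 0 \<and> p = 0")
  case True
  have "A * 0\<^sub>m n n = 0\<^sub>m n n" using assms by simp
  moreover have "(0 :: 'a) \<cdot>\<^sub>m 1\<^sub>m n + 0\<^sub>m n n = 0\<^sub>m n n" by (intro eq_matI) auto
  ultimately show ?thesis using True by simp
next
  case False
  then show ?thesis by (cases "p = 0") (simp_all add: mat_poly_def)
qed

lemma mat_poly_carrier [simp]:
  assumes "A \<in> carrier_mat n n"
  shows "mat_poly n p A \<in> carrier_mat n n"
  using assms by (induction p) (auto simp: mat_poly_pCons)

text \<open>A matrix that carries the action of \<open>B\<close> to that of \<open>A\<close> also carries the powers of \<open>B\<close> to those of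
  \<open>A\<close>, and hence their linear combinations. Commutation (\<open>B = A\<close>), conjugation by a unitary matrix and
  diagonalization are all instances.\<close>

lemma mat_poly_intertwine:
  assumes A: "A \<in> carrier_mat n n" and B: "B \<in> carrier_mat n n" and S: "S \<in> carrier_mat n n"
    and AS: "A * S = S * B"
  shows "mat_poly n p A * S = S * mat_poly n p B"
proof (induction p)
  case 0
  then show ?case using S by simp
next
  case (pCons c p)
  let ?M = "mat_poly n p A" and ?N = "mat_poly n p B"
  have M: "?M \<in> carrier_mat n n" and N: "?N \<in> carrier_mat n n" using A B by auto
  have "(c \<cdot>\<^sub>m 1\<^sub>m n + A * ?M) * S = (c \<cdot>\<^sub>m 1\<^sub>m n) * S + A * ?M * S"
    by (rule add_mult_distrib_mat) (use A M S in auto)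
  also have "(c \<cdot>\<^sub>m 1\<^sub>m n) * S = c \<cdot>\<^sub>m (1\<^sub>m n * S)"
    by (rule mult_smult_assoc_mat) (use S in auto)
  also have "c \<cdot>\<^sub>m (1\<^sub>m n * S) = c \<cdot>\<^sub>m (S * 1\<^sub>m n)" using S by simp
  also have "\<dots> = S * (c \<cdot>\<^sub>m 1\<^sub>m n)"
    by (rule mult_smult_distrib[symmetric]) (use S in auto)
  also have "A * ?M * S = A * (S * ?N)"
    using A M S pCons.IH by (simp add: assoc_mult_mat[of _ n n _ n _ n] mult_carrier_mat[of _ n n _ n])
  also have "\<dots> = S * B * ?N"
    using A S N AS by (simp flip: assoc_mult_mat[of _ n n _ n _ n])
  also have "\<dots> = S * (B * ?N)" using B S N by (simp add: assoc_mult_mat[of _ n n _ n _ n] mult_carrier_mat[of _ n n _ n])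
  also have "S * (c \<cdot>\<^sub>m 1\<^sub>m n) + S * (B * ?N) = S * (c \<cdot>\<^sub>m 1\<^sub>m n + B * ?N)"
    by (rule mult_add_distrib_mat[symmetric]) (use B S N in auto)
  finally show ?case using A B by (simp add: mat_poly_pCons)
qed

lemma mat_poly_mat_diag: "mat_poly n p (mat_diag n d) = mat_diag n (\<lambda>i. poly p (d i))"
proof (induction p)
  case 0
  then show ?case by (auto simp: mat_diag_def)
next
  case (pCons c p)
  then show ?case by (auto simp: mat_poly_pCons mat_diag_def[of _ "\<lambda>i. _ + _ * _"] intro!: eq_matI)
     (auto simp: mat_diag_def)
qed

lemma (in comm_ring_hom) mat_hom_mat_poly:
  assumes A: "A \<in> carrier_mat n n"
  shows "map_mat hom (mat_poly n p A) = mat_poly n (map_poly hom p) (map_mat hom A)"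
proof (induction p)
  case 0
  then show ?case by (auto intro!: eq_matI)
next
  case (pCons c p)
  have "map_mat hom (mat_poly n (pCons c p) A)
      = map_mat hom (c \<cdot>\<^sub>m 1\<^sub>m n + A * mat_poly n p A)"
    using A by (simp add: mat_poly_pCons)
  also have "\<dots> = hom c \<cdot>\<^sub>m 1\<^sub>m n + map_mat hom (A * mat_poly n p A)"
    using A carrier_matD[OF mat_poly_carrier[OF A, of p]]
    by (intro eq_matI) (auto simp: hom_distribs)
  also have "map_mat hom (A * mat_poly n p A) = map_mat hom A * map_mat hom (mat_poly n p A)"
    by (rule mat_hom_mult[OF A mat_poly_carrier[OF A]])
  finally show ?case using A pCons.IH by (simp add: mat_poly_pCons map_poly_pCons_hom)
qed

text \<open>Newton interpolation over a commutative ring. The only divisions are by products of differences of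
  nodes, so it suffices that these differences are units. This covers \<open>C(X)\<close>, which in general has zero
  divisors.\<close>

lemma interpolating_poly_exists:
  fixes a b :: "nat \<Rightarrow> 'r :: comm_ring_1"
  assumes "\<And>i j. i < j \<Longrightarrow> j < n \<Longrightarrow> (a j - a i) dvd 1"
  shows "\<exists>p. \<forall>i<n. poly p (a i) = b i"
  using assms
proof (induction n)
  case 0
  then show ?case by simp
next
  case (Suc n)
  then obtain p where p: "\<And>i. i < n \<Longrightarrow> poly p (a i) = b i" by auto
  define w where "w = (\<Prod>i<n. [:- a i, 1:])"
  have w: "poly w z = (\<Prod>i<n. z - a i)" for z by (simp add: w_def poly_prod)
  have "(\<Prod>i<n. a n - a i) dvd (\<Prod>i<n. 1)"
    by (rule prod_dvd_prod) (use Suc.prems in auto)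
  then obtain u where u: "1 = poly w (a n) * u" by (auto simp: w elim!: dvdE)
  \<comment> \<open>The correction term vanishes at the old nodes and repairs the value at the new one.\<close>
  define q where "q = p + Polynomial.smult ((b n - poly p (a n)) * u) w"
  have "poly q (a i) = b i" if "i < Suc n" for i
  proof (cases "i = n")
    case True
    have "poly q (a n) = poly p (a n) + (b n - poly p (a n)) * (poly w (a n) * u)"
      by (simp add: q_def algebra_simps)
    then show ?thesis using True by (simp flip: u)
  next
    case False
    then have "i < n" using that by simp
    then have "poly w (a i) = 0" unfolding w by (intro prod_zero) auto
    then show ?thesis using p[OF \<open>i < n\<close>] by (simp add: q_def)
  qed
  then show ?case by blast
qed


section \<open>Matrices with simple spectrum over a field\<close>

lemma mat_diag_cong: "(\<And>i. i < n \<Longrightarrow> f i = g i) \<Longrightarrow> mat_diag n f = mat_diag n g"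
  by (auto simp: mat_diag_def)

lemma char_poly_mat_diag: "char_poly (mat_diag n d) = (\<Prod>i<n. [:- d i, 1:])"
proof -
  have "upper_triangular (mat_diag n d)" by (auto simp: mat_diag_def)
  then have "char_poly (mat_diag n d) = (\<Prod>a\<leftarrow>diag_mat (mat_diag n d). [:- a, 1:])"
    by (intro char_poly_upper_triangular[of _ n]) auto
  also have "diag_mat (mat_diag n d) = map d [0..<n]" by (auto simp: diag_mat_def mat_diag_def)
  finally show ?thesis
    by (simp add: o_def prod.list_conv_set_nth prod.distinct_set_conv_list[symmetric] atLeast0LessThan)
qed

text \<open>The eigenvectors for the \<open>n\<close> roots form the columns of \<open>P\<close>, and the point is that \<open>P\<close> is invertible.
  If \<open>P c = 0\<close>, choose a polynomial \<open>p\<close> that is \<open>1\<close> at the \<open>k\<close>-th eigenvalue and \<open>0\<close> at the others. Then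
  \<open>p(A)\<close> is the projection to the \<open>k\<close>-th eigenspace, and \<open>0 = p(A) P c\<close> is the \<open>k\<close>-th eigenvector
  times the \<open>k\<close>-th entry of \<open>c\<close>.\<close>

lemma diagonalize_simple_spectrum:
  fixes A :: "'f :: field mat"
  assumes A: "A \<in> carrier_mat n n" and cp: "char_poly A = (\<Prod>i<n. [:- d i, 1:])"
    and inj: "inj_on d {..<n}"
  obtains P Q where "P \<in> carrier_mat n n" "Q \<in> carrier_mat n n"
    "P * Q = 1\<^sub>m n" "Q * P = 1\<^sub>m n" "A * P = P * mat_diag n d"
proof -
  have "\<exists>v. eigenvector A v (d i)" if "i < n" for i
  proof -
    have "poly (char_poly A) (d i) = 0"
      unfolding cp poly_prod using that by (intro prod_zero) auto
    then show ?thesis using eigenvalue_root_char_poly[OF A] by (simp add: eigenvalue_def)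
  qed
  then obtain v where "\<And>i. i < n \<Longrightarrow> eigenvector A (v i) (d i)" by metis
  then have v: "v i \<in> carrier_vec n" "v i \<noteq> 0\<^sub>v n" "A *\<^sub>v v i = d i \<cdot>\<^sub>v v i" if "i < n" for i
    using that A by (auto simp: eigenvector_def)
  define P where "P = mat n n (\<lambda>(i, j). v j $ i)"
  have P: "P \<in> carrier_mat n n" by (simp add: P_def)
  have col: "col P j = v j" if "j < n" for j
    using v(1)[OF that] that by (auto simp: P_def)
  have AP: "A * P = P * mat_diag n d"
  proof (rule eq_matI)
    fix i j assume "i < dim_row (P * mat_diag n d)" "j < dim_col (P * mat_diag n d)"
    then have ij: "i < n" "j < n" using P by (auto simp: mat_diag_def)
    have "(A * P) $$ (i, j) = (A *\<^sub>v v j) $ i" using A P ij by (simp add: col)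
    also have "\<dots> = d j * v j $ i" using v[OF ij(2)] ij by simp
    finally show "(A * P) $$ (i, j) = (P * mat_diag n d) $$ (i, j)"
      using ij by (simp add: mat_diag_mult_right[OF P]) (simp add: P_def)
  qed (use A P in \<open>auto simp: mat_diag_def\<close>)
  have "det P \<noteq> 0"
  proof
    assume "det P = 0"
    then obtain c where c: "c \<in> carrier_vec n" "c \<noteq> 0\<^sub>v n" "P *\<^sub>v c = 0\<^sub>v n"
      using det_0_iff_vec_prod_zero[OF P] by auto
    have "c $ k = 0" if k: "k < n" for k
    proof -
      have "(d j - d i) dvd 1" if "i < j" "j < n" for i j
        using inj_onD[OF inj, of j i] that by (auto simp: dvd_field_iff)
      then obtain p where p: "\<And>i. i < n \<Longrightarrow> poly p (d i) = (if i = k then 1 else 0)"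
        using interpolating_poly_exists[of n d "\<lambda>i. if i = k then 1 else 0"] by auto
      let ?E = "mat_diag n (\<lambda>i. if i = k then 1 else 0 :: 'f)"
      have "mat_poly n p A * P = P * mat_poly n p (mat_diag n d)"
        by (rule mat_poly_intertwine) (use A P AP in auto)
      also have "mat_poly n p (mat_diag n d) = ?E"
        unfolding mat_poly_mat_diag by (rule mat_diag_cong) (rule p)
      finally have "mat_poly n p A *\<^sub>v (P *\<^sub>v c) = P *\<^sub>v (?E *\<^sub>v c)"
        using A P c(1) by (metis assoc_mult_mat_vec mat_diag_dim mat_poly_carrier)
      moreover have "mat_poly n p A *\<^sub>v 0\<^sub>v n = 0\<^sub>v n"
        using mat_poly_carrier[OF A, of p] by (intro eq_vecI) auto
      moreover have "?E *\<^sub>v c = c $ k \<cdot>\<^sub>v unit_vec n k"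
      proof (rule eq_vecI)
        fix i assume "i < dim_vec (c $ k \<cdot>\<^sub>v unit_vec n k)"
        then have i: "i < n" by simp
        have "(?E *\<^sub>v c) $ i = (\<Sum>j<n. (if i = j then (if j = k then 1 else 0) else 0) * c $ j)"
          using i c(1) by (simp add: mat_diag_def scalar_prod_def atLeast0LessThan)
        also have "\<dots> = (\<Sum>j<n. if j = i then (if i = k then c $ j else 0) else 0)"
          by (rule sum.cong) auto
        also have "\<dots> = (if i = k then c $ k else 0)" using i by auto
        finally show "(?E *\<^sub>v c) $ i = (c $ k \<cdot>\<^sub>v unit_vec n k) $ i"
          using i k by (simp add: unit_vec_def)
      qed (simp add: mat_diag_def)
      moreover have "P *\<^sub>v (c $ k \<cdot>\<^sub>v unit_vec n k) = c $ k \<cdot>\<^sub>v v k"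
      proof -
        have "P *\<^sub>v (c $ k \<cdot>\<^sub>v unit_vec n k) = c $ k \<cdot>\<^sub>v (P *\<^sub>v unit_vec n k)"
          by (rule mult_mat_vec[OF P]) simp
        also have "P *\<^sub>v unit_vec n k = v k"
          using P k col[OF k] by (intro eq_vecI) (auto simp flip: col[OF k])
        finally show ?thesis .
      qed
      ultimately have zero: "c $ k \<cdot>\<^sub>v v k = 0\<^sub>v n" using c(3) by simp
      obtain i where i: "i < n" "v k $ i \<noteq> 0"
        using v[OF k] by (metis carrier_vecD eq_vecI index_zero_vec)
      have "(c $ k \<cdot>\<^sub>v v k) $ i = 0" using zero i by simp
      then show ?thesis using i v(1)[OF k] by simp
    qed
    then have "c = 0\<^sub>v n" using c(1) by (intro eq_vecI) auto
    then show False using c(2) by simp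
  qed
  then obtain Q where "Q \<in> carrier_mat n n" "P * Q = 1\<^sub>m n" "Q * P = 1\<^sub>m n"
    using det_non_zero_imp_unit[OF P, of "()"] by (auto simp: Units_def ring_mat_simps)
  with P AP that show thesis by blast
qed


section \<open>Evaluation at points\<close>

abbreviation eval_mat_at :: "'a :: topological_space \<Rightarrow> 'a cfun mat \<Rightarrow> complex mat" where
  "eval_mat_at x \<equiv> map_mat (\<lambda>f. cfun_apply f x)"

interpretation cfun_eval: comm_ring_hom "\<lambda>f. cfun_apply f x" for x
  by unfold_locales (transfer; simp)+

interpretation cfun_cnj: comm_ring_hom cfun_cnj
  by unfold_locales (transfer; simp add: fun_eq_iff)+

lemma cfun_eqI: "(\<And>x. cfun_apply f x = cfun_apply g x) \<Longrightarrow> f = g"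
  by transfer auto

lemma cfun_mat_eqI:
  assumes "A \<in> carrier_mat n n" "B \<in> carrier_mat n n" "\<And>x. eval_mat_at x A = eval_mat_at x B"
  shows "A = B"
proof (rule eq_matI)
  fix i j assume "i < dim_row B" "j < dim_col B"
  then show "A $$ (i, j) = B $$ (i, j)"
    using assms(1,2) arg_cong[OF assms(3), of "\<lambda>M. M $$ (i, j)"]
    by (intro cfun_eqI) simp
qed (use assms in auto)

lemma cfun_poly_eqI:
  assumes "\<And>x. eval_poly_at x p = eval_poly_at x q"
  shows "p = q"
proof (rule poly_eqI, rule cfun_eqI)
  fix k x
  show "cfun_apply (coeff p k) x = cfun_apply (coeff q k) x"
    using arg_cong[OF assms[of x], of "\<lambda>r. coeff r k"]
    by (simp add: eval_poly_at_def coeff_map_poly)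
qed

text \<open>The pointwise inverse of a nowhere vanishing continuous function is continuous.\<close>

lemma cfun_unit_iff: "f dvd 1 \<longleftrightarrow> (\<forall>x. cfun_apply f x \<noteq> 0)"
proof
  assume "f dvd 1"
  then obtain g where "f * g = 1" by (metis dvdE)
  then have "cfun_apply f x * cfun_apply g x = 1" for x
    by (metis cfun_eval.hom_mult cfun_eval.hom_one)
  then show "\<forall>x. cfun_apply f x \<noteq> 0" by (metis mult_zero_left zero_neq_one)
next
  assume "\<forall>x. cfun_apply f x \<noteq> 0"
  then have "\<exists>g. f * g = 1"
  proof transfer
    fix f :: "'a \<Rightarrow> complex"
    assume "continuous_on UNIV f" "\<forall>x. f x \<noteq> 0"
    then show "\<exists>g\<in>Collect (continuous_on UNIV). (\<lambda>x. f x * g x) = (\<lambda>_. 1)"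
      by (intro bexI[of _ "\<lambda>x. inverse (f x)"]) (auto intro!: continuous_intros)
  qed
  then show "f dvd 1" by (metis dvdI)
qed

lemma eval_poly_at_prod:
  "eval_poly_at x (\<Prod>i<n. [:- l i, 1:]) = (\<Prod>i<n. [:- cfun_apply (l i) x, 1:])"
proof -
  interpret map_poly_comm_ring_hom "\<lambda>f. cfun_apply f x" ..
  show ?thesis by (simp add: eval_poly_at_def hom_prod map_poly_pCons cfun_eval.hom_uminus)
qed

lemma poly_eval_poly_at:
  "poly (eval_poly_at x p) (cfun_apply f x) = cfun_apply (poly p f) x"
  by (simp add: eval_poly_at_def)

text \<open>At each point the \<open>n\<close> functions \<open>l\<^sub>i\<close> give all roots, so having \<open>n\<close> distinct roots forces their
  values to be distinct.\<close>

lemma multiplicity_free_splits_obtains: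
  fixes p :: "'a :: topological_space cfun poly"
  assumes "multiplicity_free p" "splits p" "degree p = n"
  obtains l where "p = (\<Prod>i<n. [:- l i, 1:])" "\<And>x. inj_on (\<lambda>i. cfun_apply (l i) x) {..<n}"
proof -
  obtain l where p: "p = (\<Prod>i<n. [:- l i, 1:])" using assms by (auto simp: splits_def)
  have "inj_on (\<lambda>i. cfun_apply (l i) x) {..<n}" for x
  proof -
    have "{z. poly (eval_poly_at x p) z = 0} = (\<lambda>i. cfun_apply (l i) x) ` {..<n}"
      unfolding p eval_poly_at_prod by (auto simp: poly_prod)
    then have "card ((\<lambda>i. cfun_apply (l i) x) ` {..<n}) = card {..<n}"
      using assms(1,3) unfolding multiplicity_free_def by (metis card_lessThan)
    then show ?thesis by (intro eq_card_imp_inj_on) auto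
  qed
  with p that show thesis by blast
qed


section \<open>Normality and unitary equivalence\<close>

lemma cfun_adjoint_carrier [simp]:
  "A \<in> carrier_mat n m \<Longrightarrow> cfun_adjoint A \<in> carrier_mat m n"
  by (simp add: cfun_adjoint_def)

lemma cfun_adjoint_mult:
  assumes "A \<in> carrier_mat n n" "B \<in> carrier_mat n n"
  shows "cfun_adjoint (A * B) = cfun_adjoint B * cfun_adjoint A"
  unfolding cfun_adjoint_def cfun_cnj.mat_hom_mult[OF assms]
  by (rule transpose_mult[of _ n n _ n]) (use assms in auto)

lemma cfun_adjoint_adjoint [simp]: "cfun_adjoint (cfun_adjoint A) = A"
proof -
  have "cfun_cnj (cfun_cnj f) = f" for f :: "'a cfun" by transfer simp
  then show ?thesis unfolding cfun_adjoint_def by (intro eq_matI) auto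
qed

lemma cfun_adjoint_one [simp]: "cfun_adjoint (1\<^sub>m n) = 1\<^sub>m n"
  by (simp add: cfun_adjoint_def cfun_cnj.mat_hom_one)

lemma unitary_equivI:
  assumes "A \<in> carrier_mat n n" "B \<in> carrier_mat n n" "U \<in> carrier_mat n n"
    and "cfun_adjoint U * U = 1\<^sub>m n" "U * cfun_adjoint U = 1\<^sub>m n" "B = cfun_adjoint U * A * U"
  shows "(A, B) \<in> unitary_equiv n"
  using assms unfolding unitary_equiv_def by blast

lemma equiv_unitary_equiv: "equiv (carrier_mat n n) (unitary_equiv n)"
proof (rule equivI)
  show "unitary_equiv n \<subseteq> carrier_mat n n \<times> carrier_mat n n"
    by (auto simp: unitary_equiv_def)
  show "refl_on (carrier_mat n n) (unitary_equiv n)"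
    by (intro refl_onI) (auto simp: unitary_equiv_def intro!: bexI[of _ "1\<^sub>m n"])
  show "sym (unitary_equiv n)"
  proof (rule symI)
    fix A B assume "(A, B) \<in> unitary_equiv n"
    then obtain U where c: "A \<in> carrier_mat n n" "B \<in> carrier_mat n n" "U \<in> carrier_mat n n"
      and U: "cfun_adjoint U * U = 1\<^sub>m n" "U * cfun_adjoint U = 1\<^sub>m n" "B = cfun_adjoint U * A * U"
      by (auto simp: unitary_equiv_def)
    let ?V = "cfun_adjoint U"
    have V: "?V \<in> carrier_mat n n" using c by simp
    have "U * B * ?V = (U * ?V) * A * (U * ?V)"
      unfolding U(3) using c V by (simp add: assoc_mult_mat[of _ n n _ n _ n] mult_carrier_mat[of _ n n _ n])
    then have A: "A = cfun_adjoint ?V * B * ?V" using U c by simp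
    show "(B, A) \<in> unitary_equiv n"
      by (rule unitary_equivI[OF c(2,1) V _ _ A]) (simp_all add: U(1,2))
  qed
  show "trans (unitary_equiv n)"
  proof (rule transI)
    fix A B C assume "(A, B) \<in> unitary_equiv n" "(B, C) \<in> unitary_equiv n"
    then obtain U V where c: "A \<in> carrier_mat n n" "B \<in> carrier_mat n n" "C \<in> carrier_mat n n"
        "U \<in> carrier_mat n n" "V \<in> carrier_mat n n"
      and U: "cfun_adjoint U * U = 1\<^sub>m n" "U * cfun_adjoint U = 1\<^sub>m n" "B = cfun_adjoint U * A * U"
      and V: "cfun_adjoint V * V = 1\<^sub>m n" "V * cfun_adjoint V = 1\<^sub>m n" "C = cfun_adjoint V * B * V"
      by (auto simp: unitary_equiv_def)
    have ad: "cfun_adjoint U \<in> carrier_mat n n" "cfun_adjoint V \<in> carrier_mat n n" using c by auto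
    note assoc = assoc_mult_mat[of _ n n _ n _ n] mult_carrier_mat[of _ n n _ n]
    have "cfun_adjoint (U * V) * (U * V) = cfun_adjoint V * (cfun_adjoint U * U) * V"
      using c ad by (simp add: cfun_adjoint_mult assoc)
    moreover have "(U * V) * cfun_adjoint (U * V) = U * (V * cfun_adjoint V) * cfun_adjoint U"
      using c ad by (simp add: cfun_adjoint_mult assoc)
    moreover have "C = cfun_adjoint (U * V) * A * (U * V)"
      unfolding V(3) U(3) using c ad by (simp add: cfun_adjoint_mult assoc)
    ultimately show "(A, C) \<in> unitary_equiv n"
      using c ad U(1,2) V(1,2) by (intro unitary_equivI[of _ _ _ "U * V"]) simp_all
  qed
qed

text \<open>\<open>B = U\<^sup>* A U\<close> says that \<open>U\<close> intertwines \<open>A\<close> and \<open>B\<close>.\<close>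

lemma mat_poly_unitary_equiv:
  fixes A B :: "'a :: topological_space cfun mat"
  assumes "(A, B) \<in> unitary_equiv n"
  shows "(mat_poly n p A, mat_poly n p B) \<in> unitary_equiv n"
proof -
  obtain U where c: "A \<in> carrier_mat n n" "B \<in> carrier_mat n n" "U \<in> carrier_mat n n"
    and U: "cfun_adjoint U * U = 1\<^sub>m n" "U * cfun_adjoint U = 1\<^sub>m n" "B = cfun_adjoint U * A * U"
    using assms by (auto simp: unitary_equiv_def)
  let ?V = "cfun_adjoint U"
  have ad: "?V \<in> carrier_mat n n" using c by simp
  note assoc = assoc_mult_mat[of _ n n _ n _ n] mult_carrier_mat[of _ n n _ n]
  have "U * B = (U * ?V) * (A * U)" unfolding U(3) using c ad by (simp add: assoc)
  then have "A * U = U * B" using U c by simp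
  then have "mat_poly n p A * U = U * mat_poly n p B"
    using c by (intro mat_poly_intertwine) auto
  then have "?V * mat_poly n p A * U = ?V * U * mat_poly n p B"
    using c ad by (simp add: assoc)
  then have "mat_poly n p B = ?V * mat_poly n p A * U"
    using U(1) left_mult_one_mat[OF mat_poly_carrier[OF c(2), of p]] by simp
  then show ?thesis
    by (intro unitary_equivI[OF mat_poly_carrier[OF c(1)] mat_poly_carrier[OF c(2)] c(3) U(1,2)])
qed

text \<open>As \<open>A\<close> commutes with \<open>A\<^sup>*\<close>, so does \<open>M = p(A)\<close>. Taking adjoints, \<open>A\<close> commutes with the adjoint
  of \<open>M\<close>, and then so does \<open>M\<close>. This argument avoids computing the adjoint of \<open>p(A)\<close> as a polynomial in
  the adjoint of \<open>A\<close>.\<close>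

lemma normal_mat_mat_poly:
  fixes A :: "'a :: topological_space cfun mat"
  assumes A: "A \<in> carrier_mat n n" and normal: "normal_mat A"
  shows "normal_mat (mat_poly n p A)"
proof -
  let ?M = "mat_poly n p A"
  have M: "?M \<in> carrier_mat n n" using A by simp
  have "?M * cfun_adjoint A = cfun_adjoint A * ?M"
    by (rule mat_poly_intertwine) (use A normal in \<open>auto simp: normal_mat_def\<close>)
  from arg_cong[OF this, of cfun_adjoint] have "A * cfun_adjoint ?M = cfun_adjoint ?M * A"
    using A M by (simp add: cfun_adjoint_mult[of _ n])
  then have "?M * cfun_adjoint ?M = cfun_adjoint ?M * ?M"
    by (intro mat_poly_intertwine) (use A M in auto)
  then show ?thesis by (simp add: normal_mat_def)
qed


section \<open>Moving the spectrum\<close>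

text \<open>Eigenvalues that are distinct at every point are nodes whose differences are units of \<open>C(X)\<close>.\<close>

lemma cfun_interpolation:
  fixes l m :: "nat \<Rightarrow> 'a :: topological_space cfun"
  assumes "\<And>x. inj_on (\<lambda>i. cfun_apply (l i) x) {..<n}"
  shows "\<exists>q. \<forall>i<n. poly q (l i) = m i"
proof (rule interpolating_poly_exists)
  fix i j assume ij: "i < j" "j < n"
  have "cfun_apply (l j) x \<noteq> cfun_apply (l i) x" for x
    using inj_onD[OF assms[of x], of j i] ij by auto
  then show "(l j - l i) dvd 1"
    by (simp add: cfun_unit_iff cfun_eval.hom_minus)
qed

text \<open>Evaluation at \<open>x\<close> is a ring homomorphism, so it carries the factorization of the characteristic
  polynomial to one with distinct complex roots.\<close>

lemma normal_mats_pointwise_diagonalize: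
  assumes A: "A \<in> normal_mats_with_char_poly n (\<Prod>i<n. [:- l i, 1:])"
    and inj: "\<And>x. inj_on (\<lambda>i. cfun_apply (l i) x) {..<n}"
  obtains P Q where "P \<in> carrier_mat n n" "Q \<in> carrier_mat n n"
    "P * Q = 1\<^sub>m n" "Q * P = 1\<^sub>m n"
    "eval_mat_at x A * P = P * mat_diag n (\<lambda>i. cfun_apply (l i) x)"
proof -
  have c: "A \<in> carrier_mat n n" and cp: "char_poly A = (\<Prod>i<n. [:- l i, 1:])"
    using A by (auto simp: normal_mats_with_char_poly_def)
  have ev: "eval_mat_at x A \<in> carrier_mat n n" using c by simp
  have "char_poly (eval_mat_at x A) = (\<Prod>i<n. [:- cfun_apply (l i) x, 1:])"
    unfolding cfun_eval.char_poly_hom[OF c] cp eval_poly_at_prod[symmetric] eval_poly_at_def ..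
  from ev this inj show thesis
    by (rule diagonalize_simple_spectrum) (rule that)
qed

text \<open>Applying a polynomial keeps the eigenvectors in \<open>P\<close> and applies the polynomial to the eigenvalues.\<close>

lemma mat_poly_eval_diagonalized:
  assumes "A \<in> carrier_mat n n" "P \<in> carrier_mat n n"
    and "eval_mat_at x A * P = P * mat_diag n (\<lambda>i. cfun_apply (l i) x)"
    and "\<And>i. i < n \<Longrightarrow> poly q (l i) = m i"
  shows "eval_mat_at x (mat_poly n q A) * P = P * mat_diag n (\<lambda>i. cfun_apply (m i) x)"
proof -
  have "eval_mat_at x (mat_poly n q A) * P
      = mat_poly n (eval_poly_at x q) (eval_mat_at x A) * P"
    using assms by (simp add: cfun_eval.mat_hom_mat_poly eval_poly_at_def)
  also have "\<dots> = P * mat_poly n (eval_poly_at x q) (mat_diag n (\<lambda>i. cfun_apply (l i) x))"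
    by (rule mat_poly_intertwine) (use assms in auto)
  also have "mat_poly n (eval_poly_at x q) (mat_diag n (\<lambda>i. cfun_apply (l i) x))
      = mat_diag n (\<lambda>i. cfun_apply (m i) x)"
    unfolding mat_poly_mat_diag poly_eval_poly_at by (rule mat_diag_cong) (simp add: assms)
  finally show ?thesis .
qed

lemma mat_poly_moves_char_poly:
  assumes A: "A \<in> normal_mats_with_char_poly n (\<Prod>i<n. [:- l i, 1:])"
    and inj: "\<And>x. inj_on (\<lambda>i. cfun_apply (l i) x) {..<n}"
    and q: "\<And>i. i < n \<Longrightarrow> poly q (l i) = m i"
  shows "mat_poly n q A \<in> normal_mats_with_char_poly n (\<Prod>i<n. [:- m i, 1:])"
proof -
  have c: "A \<in> carrier_mat n n" and normal: "normal_mat A"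
    using A by (auto simp: normal_mats_with_char_poly_def)
  let ?B = "mat_poly n q A"
  have B: "?B \<in> carrier_mat n n" using c by simp
  have "char_poly ?B = (\<Prod>i<n. [:- m i, 1:])"
  proof (rule cfun_poly_eqI)
    fix x
    let ?D = "mat_diag n (\<lambda>i. cfun_apply (m i) x)"
    obtain P Q where PQ: "P \<in> carrier_mat n n" "Q \<in> carrier_mat n n"
        "P * Q = 1\<^sub>m n" "Q * P = 1\<^sub>m n"
        "eval_mat_at x A * P = P * mat_diag n (\<lambda>i. cfun_apply (l i) x)"
      by (rule normal_mats_pointwise_diagonalize[OF A inj])
    have BP: "eval_mat_at x ?B * P = P * ?D"
      by (rule mat_poly_eval_diagonalized[OF c PQ(1,5) q])
    have "P * ?D * Q = eval_mat_at x ?B * (P * Q)"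
      unfolding BP[symmetric] using B PQ by (intro assoc_mult_mat) auto
    then have "eval_mat_at x ?B = P * ?D * Q" using B PQ by simp
    then have "similar_mat (eval_mat_at x ?B) ?D"
      using B PQ by (intro similar_matI[of _ _ P Q n]) auto
    then have "char_poly (eval_mat_at x ?B) = char_poly ?D"
      by (rule char_poly_similar)
    then show "eval_poly_at x (char_poly ?B) = eval_poly_at x (\<Prod>i<n. [:- m i, 1:])"
      unfolding cfun_eval.char_poly_hom[OF B] char_poly_mat_diag eval_poly_at_prod
      by (simp only: eval_poly_at_def)
  qed
  with B normal_mat_mat_poly[OF c normal] show ?thesis
    by (simp add: normal_mats_with_char_poly_def)
qed

text \<open>At each point both sides are diagonal with the same entries in the same basis. The composition of
  \<open>r\<close> and \<open>q\<close> is in general not the identity polynomial, but the two agree at the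
  eigenvalues \<open>l\<^sub>i\<close>.\<close>

lemma mat_poly_inverse_interpolation:
  assumes A: "A \<in> normal_mats_with_char_poly n (\<Prod>i<n. [:- l i, 1:])"
    and inj: "\<And>x. inj_on (\<lambda>i. cfun_apply (l i) x) {..<n}"
    and q: "\<And>i. i < n \<Longrightarrow> poly q (l i) = m i" and r: "\<And>i. i < n \<Longrightarrow> poly r (m i) = l i"
  shows "mat_poly n r (mat_poly n q A) = A"
proof -
  have c: "A \<in> carrier_mat n n" using A by (auto simp: normal_mats_with_char_poly_def)
  let ?B = "mat_poly n q A" and ?C = "mat_poly n r (mat_poly n q A)"
  have B: "?B \<in> carrier_mat n n" and C: "?C \<in> carrier_mat n n" using c by auto
  show ?thesis
  proof (rule cfun_mat_eqI[OF C c])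
    fix x
    obtain P Q where PQ: "P \<in> carrier_mat n n" "Q \<in> carrier_mat n n"
        "P * Q = 1\<^sub>m n" "Q * P = 1\<^sub>m n"
        "eval_mat_at x A * P = P * mat_diag n (\<lambda>i. cfun_apply (l i) x)"
      by (rule normal_mats_pointwise_diagonalize[OF A inj])
    have "eval_mat_at x ?B * P = P * mat_diag n (\<lambda>i. cfun_apply (m i) x)"
      by (rule mat_poly_eval_diagonalized[OF c PQ(1,5) q])
    then have "eval_mat_at x ?C * P = P * mat_diag n (\<lambda>i. cfun_apply (l i) x)"
      by (rule mat_poly_eval_diagonalized[OF B PQ(1) _ r])
    then have "eval_mat_at x ?C * P * Q = eval_mat_at x A * P * Q" using PQ(5) by simp
    moreover have "eval_mat_at x M * P * Q = eval_mat_at x M" if "M \<in> carrier_mat n n" for M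
    proof -
      have "eval_mat_at x M * P * Q = eval_mat_at x M * (P * Q)"
        using that PQ by (intro assoc_mult_mat) auto
      then show ?thesis using that PQ by simp
    qed
    ultimately show "eval_mat_at x ?C = eval_mat_at x A"
      using c C by (simp only:)
  qed
qed

section \<open>Counting unitary equivalence classes\<close>

text \<open>The induced map sends a class \<open>C\<close> to the class generated by its image. A class of a member of \<open>S\<close> is
  taken in all of \<open>U\<close> and may leave \<open>S\<close>; this is why \<open>f\<close> and \<open>g\<close> are required to respect \<open>R\<close> everywhere.\<close>

lemma eqpoll_quotientI:
  assumes "equiv U R" and "S \<subseteq> U" and "T \<subseteq> U"
    and f: "f \<in> S \<rightarrow> T" and g: "g \<in> T \<rightarrow> S"
    and gf: "\<And>a. a \<in> S \<Longrightarrow> g (f a) = a" and fg: "\<And>b. b \<in> T \<Longrightarrow> f (g b) = b"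
    and fR: "\<And>a b. (a, b) \<in> R \<Longrightarrow> (f a, f b) \<in> R"
    and gR: "\<And>a b. (a, b) \<in> R \<Longrightarrow> (g a, g b) \<in> R"
  shows "S // R \<approx> T // R"
proof -
  have image: "R `` (h ` (R `` {a})) = R `` {h a}"
    if "a \<in> U" and h: "\<And>a b. (a, b) \<in> R \<Longrightarrow> (h a, h b) \<in> R" for h a
  proof -
    have "R `` {h b} = R `` {h a}" if "(a, b) \<in> R" for b
      using equiv_class_eq[OF assms(1) h[OF that]] by simp
    moreover have "(a, a) \<in> R" using assms(1) \<open>a \<in> U\<close> by (auto elim: equivE dest: refl_onD)
    ultimately show ?thesis by blast
  qed
  have "bij_betw (\<lambda>C. R `` (f ` C)) (S // R) (T // R)"
  proof (rule bij_betw_byWitness[where f' = "\<lambda>C. R `` (g ` C)"])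
    have F: "R `` (f ` (R `` {a})) = R `` {f a}" if "a \<in> S" for a
      using image[of a f] fR that assms(2) by blast
    have G: "R `` (g ` (R `` {b})) = R `` {g b}" if "b \<in> T" for b
      using image[of b g] gR that assms(3) by blast
    have fS: "f a \<in> T" if "a \<in> S" for a using f that by (rule Pi_mem)
    have gT: "g b \<in> S" if "b \<in> T" for b using g that by (rule Pi_mem)
    show "\<forall>C\<in>S // R. R `` (g ` (R `` (f ` C))) = C"
    proof
      fix C assume "C \<in> S // R"
      then obtain a where "C = R `` {a}" "a \<in> S" by (rule quotientE)
      then show "R `` (g ` (R `` (f ` C))) = C" by (simp only: F G fS gf)
    qed
    show "\<forall>C\<in>T // R. R `` (f ` (R `` (g ` C))) = C"
    proof
      fix C assume "C \<in> T // R"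
      then obtain b where "C = R `` {b}" "b \<in> T" by (rule quotientE)
      then show "R `` (f ` (R `` (g ` C))) = C" by (simp only: F G gT fg)
    qed
    show "(\<lambda>C. R `` (f ` C)) ` (S // R) \<subseteq> T // R"
    proof (rule image_subsetI)
      fix C assume "C \<in> S // R"
      then obtain a where "C = R `` {a}" "a \<in> S" by (rule quotientE)
      then show "R `` (f ` C) \<in> T // R" by (simp only: F quotientI[OF fS])
    qed
    show "(\<lambda>C. R `` (g ` C)) ` (T // R) \<subseteq> S // R"
    proof (rule image_subsetI)
      fix C assume "C \<in> T // R"
      then obtain b where "C = R `` {b}" "b \<in> T" by (rule quotientE)
      then show "R `` (g ` C) \<in> S // R" by (simp only: G quotientI[OF gT])
    qed
  qed
  then show ?thesis by (auto simp: eqpoll_def)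
qed

theorem proposition3p1:
  fixes \<mu> \<mu>' :: "'a :: topological_space cfun poly" and n :: nat
  assumes "CW_complex (euclidean :: 'a topology)"
    and "connected_space (euclidean :: 'a topology)"
    and "lead_coeff \<mu> = 1" and "lead_coeff \<mu>' = 1"
    and "degree \<mu> = n" and "degree \<mu>' = n"
    and "multiplicity_free \<mu>" and "multiplicity_free \<mu>'"
    and "splits \<mu>" and "splits \<mu>'"
  shows "eqpoll (normal_mats_with_char_poly n \<mu> // unitary_equiv n)
                (normal_mats_with_char_poly n \<mu>' // unitary_equiv n)"
proof -
  obtain l where l: "\<mu> = (\<Prod>i<n. [:- l i, 1:])" "\<And>x. inj_on (\<lambda>i. cfun_apply (l i) x) {..<n}"
    by (rule multiplicity_free_splits_obtains[of \<mu> n]) (use assms in auto)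
  obtain m where m: "\<mu>' = (\<Prod>i<n. [:- m i, 1:])" "\<And>x. inj_on (\<lambda>i. cfun_apply (m i) x) {..<n}"
    by (rule multiplicity_free_splits_obtains[of \<mu>' n]) (use assms in auto)
  obtain q where q: "\<And>i. i < n \<Longrightarrow> poly q (l i) = m i" using cfun_interpolation[OF l(2)] by blast
  obtain r where r: "\<And>i. i < n \<Longrightarrow> poly r (m i) = l i" using cfun_interpolation[OF m(2)] by blast
  let ?N = "\<lambda>p. normal_mats_with_char_poly n p :: 'a cfun mat set"
  show ?thesis
  proof (rule eqpoll_quotientI[OF equiv_unitary_equiv])
    show "?N \<mu> \<subseteq> carrier_mat n n" "?N \<mu>' \<subseteq> carrier_mat n n"
      by (auto simp: normal_mats_with_char_poly_def)
    show "mat_poly n q \<in> ?N \<mu> \<rightarrow> ?N \<mu>'"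
      unfolding l(1) m(1) by (rule Pi_I) (rule mat_poly_moves_char_poly[OF _ l(2) q])
    show "mat_poly n r \<in> ?N \<mu>' \<rightarrow> ?N \<mu>"
      unfolding l(1) m(1) by (rule Pi_I) (rule mat_poly_moves_char_poly[OF _ m(2) r])
    show "mat_poly n r (mat_poly n q A) = A" if "A \<in> ?N \<mu>" for A
      using mat_poly_inverse_interpolation[OF _ l(2) q r] that unfolding l(1) .
    show "mat_poly n q (mat_poly n r B) = B" if "B \<in> ?N \<mu>'" for B
      using mat_poly_inverse_interpolation[OF _ m(2) r q] that unfolding m(1) .
  qed (rule mat_poly_unitary_equiv, assumption)+
qed

end
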